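(* Let $p>1$, let $p'$ be its conjugate exponent ($\frac1p+\frac1{p'}=1$), and let $0<\alpha,\beta\le 1$ and $-1<\mu,\nu<p-1$. For a sequence $a=\{a_n\}_{n=1}^{\infty}$ of complex numbers, define $$\widetilde{\mathbf{H}}^{\mu,\nu}_{\alpha,\beta}(a)(m):=m^{\frac{1}{p}[(\alpha-1)+\alpha\mu]}\sum_{n=1}^{\infty}\frac{n^{\frac{1}{p'}[(\beta-1)-(p'-1)\beta\nu]}}{[\max\{m^{\alpha},n^{\beta}\}]^{1+\frac{\mu-\nu}{p}}}\,a_n,\qquad m\ge 1.$$ Then $\widetilde{\mathbf{H}}^{\mu,\nu}_{\alpha,\beta}$ is bounded on $l^p$ and its operator norm is $$\|\widetilde{\mathbf{H}}^{\mu,\nu}_{\alpha,\beta}\|=\frac{p}{\alpha^{\frac1p}\beta^{\frac1{p'}}}\left(\frac{1}{1+\mu}+\frac{1}{p-1-\nu}\right).$$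
   Context: $l^p$ is the space of complex sequences $a=\{a_n\}_{n=1}^{\infty}$ with $\|a\|_p=\left(\sum_{n=1}^{\infty}|a_n|^p\right)^{1/p}<+\infty$. An operator $T$ given by such a formula is bounded on $l^p$ if for every $a\in l^p$ the series defining $T(a)(m)$ converges for all $m\geq 1$, $T(a)=\{T(a)(m)\}_{m=1}^\infty\in l^p$, and there is a constant $C$ with $\|T(a)\|_p\le C\|a\|_p$ for all $a\in l^p$; $\|T\|$ is the least such $C$. *)

theory Defs
  imports "HOL-Analysis.Analysis"
begin

text \<open>
  A sequence \<open>{a\<^sub>n}\<close> with \<open>n \<ge> 1\<close> is a function \<open>a :: nat \<Rightarrow> complex\<close> whose value at \<open>0\<close> is
  irrelevant: every sum below runs over \<open>Suc n\<close> with \<open>n \<ge> 0\<close>.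
\<close>

definition lp :: "real \<Rightarrow> (nat \<Rightarrow> complex) set" where
  "lp p = {a. summable (\<lambda>n. norm (a (Suc n)) powr p)}"

definition lp_norm :: "real \<Rightarrow> (nat \<Rightarrow> complex) \<Rightarrow> real" where
  "lp_norm p a = (\<Sum>n. norm (a (Suc n)) powr p) powr (1 / p)"

text \<open>
  Operators given by a formula \<open>T(a)(m) = w(m) \<Sum>\<^sub>n k(m,n) a\<^sub>n\<close>. The series is an ordinary,
  possibly only conditionally convergent, one. Its convergence is a separate clause of
  \<open>bounded_on_lp\<close>, since \<open>suminf\<close> is total.
\<close>

definition series_op ::
    "(nat \<Rightarrow> real) \<Rightarrow> (nat \<Rightarrow> nat \<Rightarrow> real) \<Rightarrow> (nat \<Rightarrow> complex) \<Rightarrow> nat \<Rightarrow> complex" where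
  "series_op w k a m = of_real (w m) * (\<Sum>n. of_real (k m (Suc n)) * a (Suc n))"

definition bounded_on_lp :: "real \<Rightarrow> (nat \<Rightarrow> real) \<Rightarrow> (nat \<Rightarrow> nat \<Rightarrow> real) \<Rightarrow> bool" where
  "bounded_on_lp p w k \<longleftrightarrow>
     (\<forall>a\<in>lp p. (\<forall>m\<ge>1. summable (\<lambda>n. of_real (k m (Suc n)) * a (Suc n)))
        \<and> series_op w k a \<in> lp p) \<and>
     (\<exists>C. \<forall>a\<in>lp p. lp_norm p (series_op w k a) \<le> C * lp_norm p a)"

text \<open>Meaningful only for operators bounded in the above sense, for which the least constant exists.\<close>

definition lp_op_norm :: "real \<Rightarrow> (nat \<Rightarrow> real) \<Rightarrow> (nat \<Rightarrow> nat \<Rightarrow> real) \<Rightarrow> real" where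
  "lp_op_norm p w k =
     (LEAST C. \<forall>a\<in>lp p. lp_norm p (series_op w k a) \<le> C * lp_norm p a)"

text \<open>
  The factor in front of the series, and the kernel under it, of the operator
  \<open>H\<close> with parameters \<open>\<alpha>, \<beta>, \<mu>, \<nu>\<close>; \<open>q\<close> stands for the exponent conjugate to \<open>p\<close>.
\<close>

definition H_weight :: "real \<Rightarrow> real \<Rightarrow> real \<Rightarrow> nat \<Rightarrow> real" where
  "H_weight p \<alpha> \<mu> m = real m powr (1 / p * ((\<alpha> - 1) + \<alpha> * \<mu>))"

definition H_kernel ::
    "real \<Rightarrow> real \<Rightarrow> real \<Rightarrow> real \<Rightarrow> real \<Rightarrow> real \<Rightarrow> nat \<Rightarrow> nat \<Rightarrow> real" where
  "H_kernel p q \<alpha> \<beta> \<mu> \<nu> m n =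
     real n powr (1 / q * ((\<beta> - 1) - (q - 1) * \<beta> * \<nu>)) /
     max (real m powr \<alpha>) (real n powr \<beta>) powr (1 + (\<mu> - \<nu>) / p)"

end

theory Submission
  imports Defs
begin

text \<open>
  Put \<open>A = (p - 1 - \<nu>)/p\<close> and \<open>B = (1 + \<mu>)/p\<close>, both in \<open>(0, 1)\<close>. The matrix of the operator is
  \<open>m\<^bsup>\<alpha>B - 1/p\<^esup> n\<^bsup>\<beta>A - 1/p'\<^esup> / max(m\<^sup>\<alpha>, n\<^sup>\<beta>)\<^bsup>A + B\<^esup>\<close>. Applied to the sequence \<open>n\<^bsup>-1/p\<^esup>\<close>, comparison
  with an integral of a decreasing function bounds the row sums by \<open>(1/A + 1/B)/\<beta> m\<^bsup>-1/p\<^esup>\<close>, and the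
  column sums against \<open>m\<^bsup>-1/p'\<^esup>\<close> are bounded by \<open>(1/A + 1/B)/\<alpha> n\<^bsup>-1/p'\<^esup>\<close>; the Schur test turns this into
  the upper estimate. The test sequences \<open>n\<^bsup>-1/p - \<beta>\<delta>\<^esup>\<close> almost attain it: they are mapped to at least
  \<open>R m\<^bsup>-1/p - \<alpha>\<delta>\<^esup>\<close> for large \<open>m\<close>, where \<open>R\<close> is close to \<open>(1/A + 1/B)/\<beta>\<close>, and the \<open>p\<close>-th powers of the
  norms of \<open>n\<^bsup>-1/p - \<beta>\<delta>\<^esup>\<close> and \<open>m\<^bsup>-1/p - \<alpha>\<delta>\<^esup>\<close> grow like \<open>1/(\<beta>p\<delta>)\<close> and \<open>1/(\<alpha>p\<delta>)\<close> as \<open>\<delta> \<rightarrow> 0\<close>.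
\<close>

section \<open>The comparison integral\<close>

text \<open>By the mean value theorem the quotient is \<open>(v - u) * z powr (c - 1)\<close> for
  some \<open>z\<close> between \<open>u\<close> and \<open>v\<close>, and \<open>c \<le> 1\<close>
  makes that power decreasing. The last hypothesis secures continuity at \<open>u\<close>, which may
  be 0.\<close>

lemma powr_diff_bounds:
  fixes c u v :: real
  assumes "c \<noteq> 0" "c \<le> 1" "0 \<le> u" "u \<le> v" "0 < v" and c: "0 < c \<or> 0 < u"
  shows "(v - u) * v powr (c - 1) \<le> (v powr c - u powr c) / c"
    and "0 < u \<Longrightarrow> (v powr c - u powr c) / c \<le> (v - u) * u powr (c - 1)"
proof -
  have "(v - u) * v powr (c - 1) \<le> (v powr c - u powr c) / c \<and>
    (0 < u \<longrightarrow> (v powr c - u powr c) / c \<le> (v - u) * u powr (c - 1))"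
  proof (cases "u = v")
    case False
    then have uv: "u < v" using assms by simp
    have "continuous_on {u..v} (\<lambda>t. t powr c)"
      by (rule continuous_on_powr') (use c \<open>0 \<le> u\<close> in \<open>auto intro: continuous_intros\<close>)
    moreover have "(\<lambda>t. t powr c) differentiable (at t)" if "u < t" "t < v" for t
      using has_real_derivative_powr[of t c] that \<open>0 \<le> u\<close>
      by (auto simp: real_differentiable_def)
    ultimately obtain l z where z: "u < z" "z < v" and
      d: "((\<lambda>t. t powr c) has_real_derivative l) (at z)" and
      e: "v powr c - u powr c = (v - u) * l"
      using MVT[OF uv] by blast
    have l: "l = c * z powr (c - 1)"
      by (rule DERIV_unique[OF d]) (use z \<open>0 \<le> u\<close> in \<open>auto intro: has_real_derivative_powr\<close>)
    have "(v powr c - u powr c) / c = (v - u) * z powr (c - 1)"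
      using e l \<open>c \<noteq> 0\<close> by simp
    moreover have "v powr (c - 1) \<le> z powr (c - 1)"
      using z \<open>0 \<le> u\<close> \<open>c \<le> 1\<close> by (intro powr_mono2') auto
    moreover have "z powr (c - 1) \<le> u powr (c - 1)" if "0 < u"
      using z that \<open>c \<le> 1\<close> by (intro powr_mono2') auto
    ultimately show ?thesis using uv by (auto intro!: mult_left_mono)
  qed simp
  then show "(v - u) * v powr (c - 1) \<le> (v powr c - u powr c) / c"
    and "0 < u \<Longrightarrow> (v powr c - u powr c) / c \<le> (v - u) * u powr (c - 1)" by blast+
qed

text \<open>The exponents make the integral over \<open>t > 0\<close> equal to
  \<open>(1 / a + 1 / b) / s powr b\<close>, with \<open>1 / a\<close> coming from
  \<open>t < s\<close> and \<open>1 / b\<close> from \<open>t > s\<close>. Weighted rows and columns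
  of the operator both take this form.\<close>

definition max_kernel :: "real \<Rightarrow> real \<Rightarrow> real \<Rightarrow> real \<Rightarrow> real" where
  "max_kernel a b s t = t powr (a - 1) / max s t powr (a + b)"

text \<open>An antiderivative in \<open>t\<close> of the kernel above; the constant on \<open>t > s\<close> makes it continuous at \<open>s\<close>.\<close>

definition max_kernel_primitive :: "real \<Rightarrow> real \<Rightarrow> real \<Rightarrow> real \<Rightarrow> real" where
  "max_kernel_primitive a b s t =
     (if t \<le> s then t powr a / a / s powr (a + b)
      else (1 / a + 1 / b) / s powr b - t powr - b / b)"

context
  fixes a b s :: real
  assumes ab: "0 < a" "a \<le> 1" "0 < b" and s: "0 < s"
begin

lemma max_kernel_low: "t \<le> s \<Longrightarrow> max_kernel a b s t = t powr (a - 1) / s powr (a + b)"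
  by (simp add: max_kernel_def max_def)

lemma max_kernel_high: "s \<le> t \<Longrightarrow> max_kernel a b s t = t powr (- b - 1)"
  by (simp add: max_kernel_def max_def powr_diff[symmetric] minus_diff_commute)

lemma primitive_low: "t \<le> s \<Longrightarrow> max_kernel_primitive a b s t = t powr a / a / s powr (a + b)"
  by (simp add: max_kernel_primitive_def)

text \<open>At \<open>t = s\<close> both branches give \<open>1 / a / s powr b\<close>, so
  increments on the two sides of \<open>s\<close> can be added.\<close>

lemma primitive_high:
  assumes "s \<le> t"
  shows "max_kernel_primitive a b s t = (1 / a + 1 / b) / s powr b - t powr - b / b"
proof (cases "t = s")
  case True
  then show ?thesis
    using ab s by (simp add: max_kernel_primitive_def powr_add powr_minus field_simps)
qed (use assms in \<open>simp add: max_kernel_primitive_def\<close>)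

lemma primitive_diff_low:
  assumes "0 \<le> u" "u \<le> v" "0 < v" "v \<le> s"
  shows "(v - u) * max_kernel a b s v
      \<le> max_kernel_primitive a b s v - max_kernel_primitive a b s u"
    and "0 < u \<Longrightarrow> max_kernel_primitive a b s v - max_kernel_primitive a b s u
      \<le> (v - u) * max_kernel a b s u"
proof -
  have "max_kernel_primitive a b s v - max_kernel_primitive a b s u
      = (v powr a - u powr a) / a / s powr (a + b)"
    using assms by (simp add: primitive_low diff_divide_distrib)
  then show "(v - u) * max_kernel a b s v
      \<le> max_kernel_primitive a b s v - max_kernel_primitive a b s u"
    and "0 < u \<Longrightarrow> max_kernel_primitive a b s v - max_kernel_primitive a b s u
      \<le> (v - u) * max_kernel a b s u"
    using powr_diff_bounds[of a u v, THEN divide_right_mono, of "s powr (a + b)"] assms ab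
    by (simp_all add: max_kernel_low)
qed

lemma primitive_diff_high:
  assumes "s \<le> u" "u \<le> v"
  shows "(v - u) * max_kernel a b s v
      \<le> max_kernel_primitive a b s v - max_kernel_primitive a b s u"
    and "max_kernel_primitive a b s v - max_kernel_primitive a b s u
      \<le> (v - u) * max_kernel a b s u"
proof -
  have "max_kernel_primitive a b s v - max_kernel_primitive a b s u
      = (v powr - b - u powr - b) / (- b)"
    using assms by (simp add: primitive_high diff_divide_distrib)
  then show "(v - u) * max_kernel a b s v
      \<le> max_kernel_primitive a b s v - max_kernel_primitive a b s u"
    and "max_kernel_primitive a b s v - max_kernel_primitive a b s u
      \<le> (v - u) * max_kernel a b s u"
    using powr_diff_bounds[of "- b" u v] assms ab s by (simp_all add: max_kernel_high)
qed

lemma max_kernel_antimono: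
  assumes "0 < u" "u \<le> v"
  shows "max_kernel a b s v \<le> max_kernel a b s u"
  unfolding max_kernel_def using assms ab s
  by (intro frac_le powr_mono2 powr_mono2') auto

text \<open>The increment is the integral of a decreasing function over \<open>[u, v]\<close>, hence
  lies between the length times the two endpoint values. The upper bound excludes
  \<open>u = 0\<close>, where \<open>0 powr (a - 1) = 0\<close> makes the kernel vanish.\<close>

lemma primitive_diff:
  assumes "0 \<le> u" "u \<le> v" "0 < v"
  shows "(v - u) * max_kernel a b s v
      \<le> max_kernel_primitive a b s v - max_kernel_primitive a b s u"
    and "0 < u \<Longrightarrow> max_kernel_primitive a b s v - max_kernel_primitive a b s u
      \<le> (v - u) * max_kernel a b s u"
proof -
  let ?G = "max_kernel_primitive a b s" and ?k = "max_kernel a b s"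
  consider "v \<le> s" | "s \<le> u" | "u \<le> s" "s \<le> v" by linarith
  then have "(v - u) * ?k v \<le> ?G v - ?G u \<and> (0 < u \<longrightarrow> ?G v - ?G u \<le> (v - u) * ?k u)"
  proof cases
    \<comment> \<open>The interval is cut at \<open>s\<close>; each piece obeys its own power bound,
      and antitonicity trades the value at \<open>s\<close> for an endpoint value.\<close>
    case 3
    have "(v - u) * ?k v \<le> (v - s) * ?k v + (s - u) * ?k s"
      using max_kernel_antimono[of s v] 3 s mult_left_mono[of "?k v" "?k s" "s - u"]
      by (simp add: algebra_simps)
    also have "\<dots> \<le> ?G v - ?G u"
      using primitive_diff_high(1)[of s v] primitive_diff_low(1)[of u s] 3 s assms by simp
    finally have 1: "(v - u) * ?k v \<le> ?G v - ?G u" .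
    have "?G v - ?G u \<le> (v - u) * ?k u" if "0 < u"
    proof -
      have "?G v - ?G u \<le> (v - s) * ?k s + (s - u) * ?k u"
        using primitive_diff_high(2)[of s v] primitive_diff_low(2)[of u s] 3 s assms that by simp
      also have "\<dots> \<le> (v - u) * ?k u"
        using max_kernel_antimono[of u s] 3 that mult_left_mono[of "?k s" "?k u" "v - s"]
        by (simp add: algebra_simps)
      finally show ?thesis .
    qed
    with 1 show ?thesis by blast
  qed (use primitive_diff_low primitive_diff_high assms in auto)
  then show "(v - u) * ?k v \<le> ?G v - ?G u"
    and "0 < u \<Longrightarrow> ?G v - ?G u \<le> (v - u) * ?k u" by blast+
qed

text \<open>The right side is the limit of the primitive at infinity, that is, the full
  integral.\<close>

lemma primitive_le: "max_kernel_primitive a b s t \<le> (1 / a + 1 / b) / s powr b" if "0 \<le> t"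
proof (cases "t \<le> s")
  case True
  have "max_kernel_primitive a b s t \<le> max_kernel_primitive a b s s"
    using True ab s that
    by (simp add: max_kernel_primitive_def divide_right_mono powr_mono2)
  also have "\<dots> \<le> (1 / a + 1 / b) / s powr b"
    using ab by (simp add: primitive_high)
  finally show ?thesis .
qed (use ab in \<open>simp add: max_kernel_primitive_def\<close>)

lemma max_kernel_nonneg: "0 \<le> max_kernel a b s t"
  by (simp add: max_kernel_def)

text \<open>Each term is the value at the right endpoint of \<open>[n, n + 1]\<close>, hence at most
  the integral there, and the integrals telescope.\<close>

lemma sum_max_kernel_le:
  "(\<Sum>n<N. max_kernel a b s (real (Suc n))) \<le> (1 / a + 1 / b) / s powr b"
proof -
  let ?G = "max_kernel_primitive a b s"
  have "(\<Sum>n<N. max_kernel a b s (real (Suc n)))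
      \<le> (\<Sum>n<N. ?G (real (Suc n)) - ?G (real n))"
    using primitive_diff(1)[of "real n" "real (Suc n)" for n] by (intro sum_mono) simp
  also have "\<dots> = ?G (real N) - ?G (real 0)"
    by (rule sum_lessThan_telescope)
  also have "?G (real 0) = 0"
    using s ab by (simp add: max_kernel_primitive_def)
  finally show ?thesis using primitive_le[of "real N"] by simp
qed

lemma summable_max_kernel: "summable (\<lambda>n. max_kernel a b s (real (Suc n)))"
  by (rule summableI_nonneg_bounded[OF max_kernel_nonneg sum_max_kernel_le])

lemma suminf_max_kernel_le:
  "(\<Sum>n. max_kernel a b s (real (Suc n))) \<le> (1 / a + 1 / b) / s powr b"
  by (rule suminf_le_const[OF summable_max_kernel sum_max_kernel_le])

text \<open>Left endpoint values dominate the integrals from 1 on, so only the integral over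
  \<open>[0, 1]\<close> is missing. Since \<open>1 \<le> s\<close>, it equals
  \<open>1 / a / s powr (a + b)\<close>, which is the source of \<open>s powr - a\<close>.\<close>

lemma suminf_max_kernel_ge:
  assumes "1 \<le> s"
  shows "((1 - s powr - a) / a + 1 / b) / s powr b \<le> (\<Sum>n. max_kernel a b s (real (Suc n)))"
proof (rule LIMSEQ_le)
  let ?G = "max_kernel_primitive a b s"
  have "(\<lambda>N. (1 / a + 1 / b) / s powr b - real (Suc N) powr - b / b - 1 / a / s powr (a + b))
      \<longlonglongrightarrow> (1 / a + 1 / b) / s powr b - 0 / b - 1 / a / s powr (a + b)"
    using ab by (intro tendsto_intros tendsto_neg_powr
      filterlim_compose[OF filterlim_real_sequentially filterlim_Suc]) auto
  \<comment> \<open>For large \<open>N\<close> the upper end lies on the branch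
    \<open>t \<ge> s\<close>, while 1 lies on the branch \<open>t \<le> s\<close>.\<close>
  moreover have "\<forall>\<^sub>F N in sequentially. (1 / a + 1 / b) / s powr b - real (Suc N) powr - b / b
      - 1 / a / s powr (a + b) = ?G (real (Suc N)) - ?G 1"
    using eventually_ge_at_top[of "nat \<lceil>s\<rceil>"]
    by eventually_elim (use assms in \<open>auto simp: primitive_high primitive_low\<close>)
  ultimately have "(\<lambda>N. ?G (real (Suc N)) - ?G 1)
      \<longlonglongrightarrow> (1 / a + 1 / b) / s powr b - 0 / b - 1 / a / s powr (a + b)"
    by (rule Lim_transform_eventually)
  also have "(1 / a + 1 / b) / s powr b - 0 / b - 1 / a / s powr (a + b)
      = ((1 - s powr - a) / a + 1 / b) / s powr b"
    using ab s by (simp add: powr_add powr_minus field_simps)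
  finally show "(\<lambda>N. ?G (real (Suc N)) - ?G 1)
      \<longlonglongrightarrow> ((1 - s powr - a) / a + 1 / b) / s powr b" .
  show "(\<lambda>N. \<Sum>n<N. max_kernel a b s (real (Suc n)))
      \<longlonglongrightarrow> (\<Sum>n. max_kernel a b s (real (Suc n)))"
    by (rule summable_LIMSEQ[OF summable_max_kernel])
  have "?G (real (Suc N)) - ?G 1 \<le> (\<Sum>n<N. max_kernel a b s (real (Suc n)))" for N
  proof -
    have "?G (real (Suc N)) - ?G 1 = (\<Sum>n<N. ?G (real (Suc (Suc n))) - ?G (real (Suc n)))"
      using sum_lessThan_telescope[of "\<lambda>n. ?G (real (Suc n))" N] by simp
    also have "\<dots> \<le> (\<Sum>n<N. max_kernel a b s (real (Suc n)))"
      using primitive_diff(2)[of "real (Suc n)" "real (Suc (Suc n))" for n]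
      by (intro sum_mono) simp
    finally show ?thesis .
  qed
  then show "\<exists>M. \<forall>N\<ge>M. ?G (real (Suc N)) - ?G 1 \<le> (\<Sum>n<N. max_kernel a b s (real (Suc n)))"
    by blast
qed

end

section \<open>The Schur test\<close>

text \<open>Jensen's inequality for \<open>t powr p\<close> with unnormalised weights: the tangent
  line inequality at the weighted mean is summed.\<close>

lemma sum_powr_le_sum_powr:
  fixes w x :: "'i \<Rightarrow> real"
  assumes "1 < p" and w: "\<And>i. i \<in> I \<Longrightarrow> 0 \<le> w i" and x: "\<And>i. i \<in> I \<Longrightarrow> 0 \<le> x i"
  shows "(\<Sum>i\<in>I. w i * x i) powr p \<le> (\<Sum>i\<in>I. w i) powr (p - 1) * (\<Sum>i\<in>I. w i * x i powr p)"
proof -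
  define W where "W = (\<Sum>i\<in>I. w i)"
  define S where "S = (\<Sum>i\<in>I. w i * x i)"
  have "0 \<le> W" "0 \<le> S" unfolding W_def S_def using w x by (auto intro!: sum_nonneg)
  show ?thesis
  proof (cases "S = 0")
    case True
    then show ?thesis using w by (auto simp: S_def intro!: sum_nonneg mult_nonneg_nonneg)
  next
    case False
    \<comment> \<open>A sum over an infinite set is 0 by convention, so \<open>S \<noteq> 0\<close>
      forces finiteness.\<close>
    then have "finite I" using S_def by (meson sum.infinite)
    have "W \<noteq> 0"
    proof
      assume "W = 0"
      then have "\<forall>i\<in>I. w i = 0" using \<open>finite I\<close> w by (simp add: W_def sum_nonneg_eq_0_iff)
      with False show False by (simp add: S_def)
    qed
    with False \<open>0 \<le> W\<close> \<open>0 \<le> S\<close> have pos: "0 < W" "0 < S" by auto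
    define X where "X = S / W"
    have X: "0 < X" using pos by (simp add: X_def)
    define q where "q = p / (p - 1)"
    have q: "1 < q" "1 / p + 1 / q = 1" "(p - 1) * q = p"
      using \<open>1 < p\<close> by (auto simp: q_def field_simps)
    \<comment> \<open>The graph of \<open>y powr p\<close> lies above its tangent at the mean
      \<open>X\<close>. This is Young's inequality for \<open>y\<close> and
      \<open>X powr (p - 1)\<close>, since \<open>(p - 1) * q = p\<close>.\<close>
    have tangent: "p * (y * X powr (p - 1)) \<le> y powr p + (p - 1) * X powr p" if "0 \<le> y" for y
    proof -
      have "y * X powr (p - 1) \<le> y powr p / p + (X powr (p - 1)) powr q / q"
        using \<open>1 < p\<close> q that X by (intro Youngs_inequality) auto
      then have "p * (y * X powr (p - 1)) \<le> p * (y powr p / p + X powr p / q)"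
        using \<open>1 < p\<close> by (simp add: powr_powr q)
      also have "\<dots> = y powr p + (p - 1) * X powr p"
        using \<open>1 < p\<close> by (simp add: q_def field_simps)
      finally show ?thesis .
    qed
    have "(\<Sum>i\<in>I. w i * (p * (x i * X powr (p - 1))))
        \<le> (\<Sum>i\<in>I. w i * (x i powr p + (p - 1) * X powr p))"
      using w x by (intro sum_mono mult_left_mono tangent)
    also have "(\<Sum>i\<in>I. w i * (p * (x i * X powr (p - 1)))) = p * S * X powr (p - 1)"
      by (simp add: S_def sum_distrib_left sum_distrib_right mult_ac)
    also have "p * S * X powr (p - 1) = p * W * X powr p"
      using pos X by (simp add: X_def powr_diff)
    also have "(\<Sum>i\<in>I. w i * (x i powr p + (p - 1) * X powr p))
        = (\<Sum>i\<in>I. w i * x i powr p) + (p - 1) * W * X powr p"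
      by (simp add: W_def distrib_left sum.distrib sum_distrib_left sum_distrib_right mult_ac)
    finally have "W * X powr p \<le> (\<Sum>i\<in>I. w i * x i powr p)"
      by (simp add: algebra_simps)
    then have "W powr (p - 1) * (W * X powr p) \<le> W powr (p - 1) * (\<Sum>i\<in>I. w i * x i powr p)"
      by (intro mult_left_mono) auto
    also have "W powr (p - 1) * (W * X powr p) = S powr p"
      using pos by (simp add: X_def powr_diff powr_divide)
    finally show ?thesis by (simp add: S_def W_def)
  qed
qed

text \<open>In each row, Jensen with weights \<open>K m n * u n\<close> at the points
  \<open>b n / u n\<close> and the row bound give a factor \<open>v m powr (p - 1)\<close>. After
  exchanging the sums, the column bound produces \<open>u n powr (p - 1)\<close>, which
  cancels.\<close>

lemma Schur_test:
  fixes K :: "'i \<Rightarrow> 'j \<Rightarrow> real"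
  assumes "1 < p" "0 \<le> A"
    and K: "\<And>m n. m \<in> I \<Longrightarrow> n \<in> J \<Longrightarrow> 0 \<le> K m n"
    and u: "\<And>n. n \<in> J \<Longrightarrow> 0 < u n" and v: "\<And>m. m \<in> I \<Longrightarrow> 0 < v m"
    and b: "\<And>n. n \<in> J \<Longrightarrow> 0 \<le> b n"
    and row: "\<And>m. m \<in> I \<Longrightarrow> (\<Sum>n\<in>J. K m n * u n) \<le> A * v m"
    and col: "\<And>n. n \<in> J \<Longrightarrow> (\<Sum>m\<in>I. K m n * v m powr (p - 1)) \<le> B * u n powr (p - 1)"
  shows "(\<Sum>m\<in>I. (\<Sum>n\<in>J. K m n * b n) powr p) \<le> A powr (p - 1) * B * (\<Sum>n\<in>J. b n powr p)"
proof -
  have "(\<Sum>n\<in>J. K m n * b n) powr p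
      \<le> A powr (p - 1) * (\<Sum>n\<in>J. K m n * v m powr (p - 1) * (b n powr p / u n powr (p - 1)))"
    if m: "m \<in> I" for m
  proof -
    have "(\<Sum>n\<in>J. K m n * b n) powr p = (\<Sum>n\<in>J. K m n * u n * (b n / u n)) powr p"
      using u by (intro arg_cong[where f = "\<lambda>x. x powr p"] sum.cong) (auto simp: less_imp_neq[symmetric])
    also have "\<dots> \<le> (\<Sum>n\<in>J. K m n * u n) powr (p - 1) * (\<Sum>n\<in>J. K m n * u n * (b n / u n) powr p)"
      using m K u b \<open>1 < p\<close> by (intro sum_powr_le_sum_powr) (auto simp: less_imp_le)
    also have "\<dots> \<le> (A * v m) powr (p - 1) * (\<Sum>n\<in>J. K m n * u n * (b n / u n) powr p)"
      using m K u b \<open>1 < p\<close> row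
      by (intro mult_right_mono powr_mono2 sum_nonneg mult_nonneg_nonneg) (auto simp: less_imp_le)
    also have "(\<Sum>n\<in>J. K m n * u n * (b n / u n) powr p)
        = (\<Sum>n\<in>J. K m n * (b n powr p / u n powr (p - 1)))"
      using u b by (intro sum.cong) (force simp: powr_divide powr_diff less_imp_le)+
    finally show ?thesis
      using \<open>0 \<le> A\<close> v[OF m] by (simp add: powr_mult sum_distrib_left mult_ac)
  qed
  then have "(\<Sum>m\<in>I. (\<Sum>n\<in>J. K m n * b n) powr p)
      \<le> (\<Sum>m\<in>I. A powr (p - 1) *
          (\<Sum>n\<in>J. K m n * v m powr (p - 1) * (b n powr p / u n powr (p - 1))))"
    by (rule sum_mono)
  also have "\<dots> = A powr (p - 1) *
      (\<Sum>n\<in>J. (\<Sum>m\<in>I. K m n * v m powr (p - 1)) * (b n powr p / u n powr (p - 1)))"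
    by (subst sum_distrib_left[symmetric], subst sum.swap) (simp only: sum_distrib_right)
  also have "\<dots> \<le> A powr (p - 1) *
      (\<Sum>n\<in>J. B * u n powr (p - 1) * (b n powr p / u n powr (p - 1)))"
    by (intro mult_left_mono sum_mono mult_right_mono col) auto
  also have "(\<Sum>n\<in>J. B * u n powr (p - 1) * (b n powr p / u n powr (p - 1)))
      = (\<Sum>n\<in>J. B * b n powr p)"
    using u by (intro sum.cong) force+
  finally show ?thesis by (simp add: sum_distrib_left mult_ac)
qed

lemma lp_norm_nonneg: "0 \<le> lp_norm p a"
  by (simp add: lp_norm_def)

text \<open>The finite test, applied to the absolute values, bounds all finite sections by one
  constant \<open>E\<close>. Letting first the columns and then the rows exhaust the matrix gives
  convergence and the norm bound.\<close>

lemma Schur_test_lp: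
  assumes "1 < p" "0 \<le> A" "0 \<le> B"
    and w: "\<And>m. 0 < w (Suc m)" and k: "\<And>m n. 0 \<le> k (Suc m) (Suc n)"
    and u: "\<And>n. 0 < u n" and v: "\<And>m. 0 < v m"
    and row: "\<And>m N. (\<Sum>n<N. w (Suc m) * k (Suc m) (Suc n) * u n) \<le> A * v m"
    and col: "\<And>n M. (\<Sum>m<M. w (Suc m) * k (Suc m) (Suc n) * v m powr (p - 1))
        \<le> B * u n powr (p - 1)"
    and a: "a \<in> lp p"
  shows "summable (\<lambda>n. of_real (k (Suc m) (Suc n)) * a (Suc n))"
    and "series_op w k a \<in> lp p"
    and "lp_norm p (series_op w k a) \<le> (A powr (p - 1) * B) powr (1 / p) * lp_norm p a"
proof -
  define E where "E = A powr (p - 1) * B * (\<Sum>n. norm (a (Suc n)) powr p)"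
  define S where "S N m = (\<Sum>n<N. w (Suc m) * k (Suc m) (Suc n) * norm (a (Suc n)))" for N m
  define T where "T m = (\<Sum>n. w (Suc m) * k (Suc m) (Suc n) * norm (a (Suc n)))" for m
  have a': "summable (\<lambda>n. norm (a (Suc n)) powr p)" using a by (simp add: lp_def)
  have term_nonneg: "0 \<le> w (Suc m) * k (Suc m) (Suc n) * norm (a (Suc n))" for m n
    using w k by (simp add: less_imp_le)
  have S_nonneg: "0 \<le> S N m" for N m
    unfolding S_def by (intro sum_nonneg term_nonneg)
  have bound: "(\<Sum>m<M. S N m powr p) \<le> E" for N M
  proof -
    have "(\<Sum>m<M. S N m powr p)
        \<le> A powr (p - 1) * B * (\<Sum>n<N. norm (a (Suc n)) powr p)"
      unfolding S_def using w k u v \<open>1 < p\<close> \<open>0 \<le> A\<close>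
      by (intro Schur_test[where u = u and v = v] row col) (auto simp: less_imp_le)
    also have "\<dots> \<le> E"
      unfolding E_def using \<open>0 \<le> A\<close> \<open>0 \<le> B\<close> a'
      by (intro mult_left_mono sum_le_suminf) auto
    finally show ?thesis .
  qed
  \<comment> \<open>A single row is dominated by the sum over rows, so its partial sums are bounded
    and its series converges absolutely.\<close>
  have "S N m \<le> E powr (1 / p)" for N m
  proof -
    have "S N m powr p \<le> (\<Sum>m<Suc m. S N m powr p)"
      by (simp add: sum_nonneg)
    also have "\<dots> \<le> E" by (rule bound)
    finally have "(S N m powr p) powr (1 / p) \<le> E powr (1 / p)"
      using \<open>1 < p\<close> by (intro powr_mono2) auto
    then show ?thesis using S_nonneg \<open>1 < p\<close> by (simp add: powr_powr)
  qed
  then have summable_T: "summable (\<lambda>n. w (Suc m) * k (Suc m) (Suc n) * norm (a (Suc n)))" for m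
    unfolding S_def by (intro summableI_nonneg_bounded[OF term_nonneg])
  then have S_T: "(\<lambda>N. S N m) \<longlonglongrightarrow> T m" for m
    unfolding S_def T_def by (rule summable_LIMSEQ)
  \<comment> \<open>\<open>N\<close> tends to infinity while \<open>M\<close> stays fixed, so only
    finitely many limits are added.\<close>
  have T_bound: "(\<Sum>m<M. T m powr p) \<le> E" for M
  proof (rule LIMSEQ_le_const2)
    show "(\<lambda>N. \<Sum>m<M. S N m powr p) \<longlonglongrightarrow> (\<Sum>m<M. T m powr p)"
      using S_nonneg \<open>1 < p\<close> by (intro tendsto_sum tendsto_powr2 S_T tendsto_const) auto
  qed (use bound in auto)
  have summable_norm_k: "summable (\<lambda>n. norm (complex_of_real (k (Suc m) (Suc n)) * a (Suc n)))" for m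
  proof -
    have "summable (\<lambda>n. inverse (w (Suc m)) * (w (Suc m) * k (Suc m) (Suc n) * norm (a (Suc n))))"
      by (rule summable_mult[OF summable_T])
    then show ?thesis
      using w[of m] k by (simp add: norm_mult mult.assoc[symmetric])
  qed
  then show "summable (\<lambda>n. of_real (k (Suc m) (Suc n)) * a (Suc n))"
    by (rule summable_norm_cancel)
  have op_le: "norm (series_op w k a (Suc m)) \<le> T m" for m
  proof -
    have "norm (series_op w k a (Suc m))
        \<le> w (Suc m) * (\<Sum>n. norm (complex_of_real (k (Suc m) (Suc n)) * a (Suc n)))"
      unfolding series_op_def norm_mult[of "of_real (w (Suc m))"] norm_of_real
      using w[of m] by (simp only: abs_of_pos) (intro mult_left_mono summable_norm summable_norm_k, simp)
    also have "\<dots> = (\<Sum>n. w (Suc m) * norm (complex_of_real (k (Suc m) (Suc n)) * a (Suc n)))"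
      by (rule suminf_mult[OF summable_norm_k, symmetric])
    also have "\<dots> = T m"
      unfolding T_def using k by (simp add: norm_mult mult.assoc)
    finally show ?thesis .
  qed
  have op_bound: "(\<Sum>m<M. norm (series_op w k a (Suc m)) powr p) \<le> E" for M
    using \<open>1 < p\<close> op_le
    by (intro order_trans[OF _ T_bound[of M]] sum_mono powr_mono2) auto
  then have summable_op: "summable (\<lambda>m. norm (series_op w k a (Suc m)) powr p)"
    by (intro summableI_nonneg_bounded) auto
  then show "series_op w k a \<in> lp p" by (simp add: lp_def)
  have "(\<Sum>m. norm (series_op w k a (Suc m)) powr p) \<le> E"
    by (rule suminf_le_const[OF summable_op op_bound])
  then have "lp_norm p (series_op w k a) \<le> E powr (1 / p)"
    unfolding lp_norm_def using \<open>1 < p\<close> by (intro powr_mono2 suminf_nonneg summable_op) auto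
  then show "lp_norm p (series_op w k a) \<le> (A powr (p - 1) * B) powr (1 / p) * lp_norm p a"
    unfolding E_def lp_norm_def using \<open>0 \<le> B\<close> by (simp add: powr_mult suminf_nonneg a')
qed

section \<open>The operator norm\<close>

lemma max_powr:
  fixes x y c :: real
  assumes "0 \<le> x" "0 \<le> y" "0 \<le> c"
  shows "max x y powr c = max (x powr c) (y powr c)"
  using assms powr_mono2[of c x y] powr_mono2[of c y x] by (auto simp: max_def)

context
  fixes p q \<alpha> \<beta> \<mu> \<nu> A B :: real
  assumes p: "1 < p" and pq: "1 / p + 1 / q = 1"
    and \<alpha>: "0 < \<alpha>" "\<alpha> \<le> 1" and \<beta>: "0 < \<beta>" "\<beta> \<le> 1"
  defines "A \<equiv> (p - 1 - \<nu>) / p" and "B \<equiv> (1 + \<mu>) / p"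
  assumes A: "0 < A" "A < 1" and B: "0 < B" "B < 1"
begin

private abbreviation (input) "w \<equiv> H_weight p \<alpha> \<mu>"
private abbreviation (input) "k \<equiv> H_kernel p q \<alpha> \<beta> \<mu> \<nu>"

lemma q_inverse: "1 / q = 1 - 1 / p"
  using pq by simp

section \<open>Rows and columns of the matrix as max kernels\<close>

lemma H_kernel_eq:
  "w m * k m n = real m powr (\<alpha> * B - 1 / p) * real n powr (\<beta> * A - 1 / q)
     / max (real m powr \<alpha>) (real n powr \<beta>) powr (A + B)"
proof -
  \<comment> \<open>The case \<open>q = 0\<close> is impossible: \<open>1 / 0 = 0\<close> would
    force \<open>p = 1\<close>.\<close>
  have q: "q = p / (p - 1)" using q_inverse p by (cases "q = 0") (auto simp: field_simps)
  have "1 / p * (\<alpha> - 1 + \<alpha> * \<mu>) = \<alpha> * B - 1 / p"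
    using p by (simp add: B_def field_simps)
  moreover have "1 / q * ((\<beta> - 1) - (q - 1) * \<beta> * \<nu>) = \<beta> * A - 1 / q"
    using p by (simp add: A_def q field_simps)
  moreover have "1 + (\<mu> - \<nu>) / p = A + B"
    using p by (simp add: A_def B_def field_simps)
  ultimately show ?thesis by (simp add: H_weight_def H_kernel_def)
qed

text \<open>The maximum is \<open>max (m powr (\<alpha> / \<beta>)) n\<close> raised to
  \<open>\<beta>\<close>, so a row is a max kernel in \<open>n\<close>. The factor
  \<open>n powr - (\<beta> * \<delta>)\<close> only moves \<open>\<beta> * \<delta>\<close> from
  \<open>a\<close> to \<open>b\<close>. The upper estimate takes \<open>\<delta> = 0\<close>, the
  test sequences \<open>\<delta> > 0\<close>.\<close>

lemma row_kernel:
  "w m * k m n * real n powr - (1 / p + \<beta> * \<delta>)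
    = real m powr (\<alpha> * B - 1 / p)
      * max_kernel (\<beta> * (A - \<delta>)) (\<beta> * (B + \<delta>)) (real m powr (\<alpha> / \<beta>)) (real n)"
proof -
  have "max (real m powr (\<alpha> / \<beta>)) (real n) powr (\<beta> * (A - \<delta>) + \<beta> * (B + \<delta>))
      = (max (real m powr (\<alpha> / \<beta>)) (real n) powr \<beta>) powr (A + B)"
    by (simp add: powr_powr algebra_simps)
  also have "max (real m powr (\<alpha> / \<beta>)) (real n) powr \<beta> = max (real m powr \<alpha>) (real n powr \<beta>)"
    using \<beta> by (simp add: max_powr powr_powr)
  finally have 1: "max (real m powr (\<alpha> / \<beta>)) (real n) powr (\<beta> * (A - \<delta>) + \<beta> * (B + \<delta>))
      = max (real m powr \<alpha>) (real n powr \<beta>) powr (A + B)" .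
  have "\<beta> * A - 1 / q + - (1 / p + \<beta> * \<delta>) = \<beta> * (A - \<delta>) - 1"
    by (simp add: q_inverse algebra_simps)
  then have "real n powr (\<beta> * A - 1 / q) * real n powr - (1 / p + \<beta> * \<delta>)
      = real n powr (\<beta> * (A - \<delta>) - 1)"
    by (simp only: powr_add[symmetric])
  then show ?thesis unfolding H_kernel_eq max_kernel_def 1 by (simp add: mult.assoc)
qed

text \<open>The mirror image for columns, with \<open>A\<close> and \<open>B\<close> exchanged; no
  \<open>\<delta>\<close> appears because the lower estimate works with rows alone.\<close>

lemma column_kernel:
  "w m * k m n * real m powr - (1 / q)
    = real n powr (\<beta> * A - 1 / q) * max_kernel (\<alpha> * B) (\<alpha> * A) (real n powr (\<beta> / \<alpha>)) (real m)"
proof -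
  have "max (real n powr (\<beta> / \<alpha>)) (real m) powr (\<alpha> * B + \<alpha> * A)
      = (max (real n powr (\<beta> / \<alpha>)) (real m) powr \<alpha>) powr (A + B)"
    by (simp add: powr_powr algebra_simps)
  also have "max (real n powr (\<beta> / \<alpha>)) (real m) powr \<alpha> = max (real m powr \<alpha>) (real n powr \<beta>)"
    using \<alpha> by (simp add: max_powr powr_powr max.commute)
  finally have 1: "max (real n powr (\<beta> / \<alpha>)) (real m) powr (\<alpha> * B + \<alpha> * A)
      = max (real m powr \<alpha>) (real n powr \<beta>) powr (A + B)" .
  have "\<alpha> * B - 1 / p + - (1 / q) = \<alpha> * B - 1"
    by (simp add: q_inverse algebra_simps)
  then have "real m powr (\<alpha> * B - 1 / p) * real m powr - (1 / q) = real m powr (\<alpha> * B - 1)"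
    by (simp only: powr_add[symmetric])
  then show ?thesis unfolding H_kernel_eq max_kernel_def 1 by (simp add: mult_ac)
qed

section \<open>The upper estimate\<close>

lemma row_sum_le:
  "(\<Sum>n<N. w (Suc m) * k (Suc m) (Suc n) * real (Suc n) powr - (1 / p))
    \<le> (1 / A + 1 / B) / \<beta> * real (Suc m) powr - (1 / p)"
proof -
  let ?s = "real (Suc m) powr (\<alpha> / \<beta>)"
  have "(\<Sum>n<N. w (Suc m) * k (Suc m) (Suc n) * real (Suc n) powr - (1 / p))
      = real (Suc m) powr (\<alpha> * B - 1 / p) * (\<Sum>n<N. max_kernel (\<beta> * A) (\<beta> * B) ?s (real (Suc n)))"
    using row_kernel[of "Suc m" "Suc n" 0 for n] by (simp add: sum_distrib_left)
  also have "\<dots> \<le> real (Suc m) powr (\<alpha> * B - 1 / p) *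
      ((1 / (\<beta> * A) + 1 / (\<beta> * B)) / ?s powr (\<beta> * B))"
    using A B \<beta> by (intro mult_left_mono sum_max_kernel_le) (auto intro: mult_le_one)
  also have "?s powr (\<beta> * B) = real (Suc m) powr (\<alpha> * B)"
    using \<beta> by (simp add: powr_powr)
  also have "real (Suc m) powr (\<alpha> * B - 1 / p) = real (Suc m) powr (\<alpha> * B) * real (Suc m) powr - (1 / p)"
    by (simp flip: powr_add)
  also have "real (Suc m) powr (\<alpha> * B) * real (Suc m) powr - (1 / p) *
      ((1 / (\<beta> * A) + 1 / (\<beta> * B)) / real (Suc m) powr (\<alpha> * B))
      = (1 / A + 1 / B) / \<beta> * real (Suc m) powr - (1 / p)"
    using A B \<beta> by (simp add: field_simps)
  finally show ?thesis .
qed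

lemma column_sum_le:
  "(\<Sum>m<M. w (Suc m) * k (Suc m) (Suc n) * real (Suc m) powr - (1 / q))
    \<le> (1 / A + 1 / B) / \<alpha> * real (Suc n) powr - (1 / q)"
proof -
  let ?s = "real (Suc n) powr (\<beta> / \<alpha>)"
  have "(\<Sum>m<M. w (Suc m) * k (Suc m) (Suc n) * real (Suc m) powr - (1 / q))
      = real (Suc n) powr (\<beta> * A - 1 / q) * (\<Sum>m<M. max_kernel (\<alpha> * B) (\<alpha> * A) ?s (real (Suc m)))"
    using column_kernel[of "Suc m" "Suc n" for m] by (simp add: sum_distrib_left)
  also have "\<dots> \<le> real (Suc n) powr (\<beta> * A - 1 / q) *
      ((1 / (\<alpha> * B) + 1 / (\<alpha> * A)) / ?s powr (\<alpha> * A))"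
    using A B \<alpha> by (intro mult_left_mono sum_max_kernel_le) (auto intro: mult_le_one)
  also have "?s powr (\<alpha> * A) = real (Suc n) powr (\<beta> * A)"
    using \<alpha> by (simp add: powr_powr)
  also have "real (Suc n) powr (\<beta> * A - 1 / q) = real (Suc n) powr (\<beta> * A) * real (Suc n) powr - (1 / q)"
    by (simp flip: powr_add)
  also have "real (Suc n) powr (\<beta> * A) * real (Suc n) powr - (1 / q) *
      ((1 / (\<alpha> * B) + 1 / (\<alpha> * A)) / real (Suc n) powr (\<beta> * A))
      = (1 / A + 1 / B) / \<alpha> * real (Suc n) powr - (1 / q)"
    using A B \<alpha> by (simp add: field_simps)
  finally show ?thesis .
qed

text \<open>Schur test with both weights equal to the power \<open>- (1 / p)\<close>: since
  \<open>(p - 1) / p = 1 / q\<close>, the column condition then involves exactly the power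
  \<open>- (1 / q)\<close>.\<close>

lemma operator_bounds:
  assumes "a \<in> lp p"
  shows "summable (\<lambda>n. of_real (k (Suc m) (Suc n)) * a (Suc n))"
    and "series_op w k a \<in> lp p"
    and "lp_norm p (series_op w k a)
      \<le> (1 / A + 1 / B) / (\<alpha> powr (1 / p) * \<beta> powr (1 / q)) * lp_norm p a"
proof -
  let ?C = "1 / A + 1 / B"
  have weights: "(real (Suc i) powr - (1 / p)) powr (p - 1) = real (Suc i) powr - (1 / q)" for i
    using p by (simp add: powr_powr q_inverse field_simps)
  have col: "(\<Sum>m<M. w (Suc m) * k (Suc m) (Suc n) * (real (Suc m) powr - (1 / p)) powr (p - 1))
    \<le> ?C / \<alpha> * (real (Suc n) powr - (1 / p)) powr (p - 1)" for n M
    unfolding weights by (rule column_sum_le)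
  have w: "0 < w (Suc m)" and k: "0 \<le> k (Suc m) (Suc n)" for m n
    by (simp_all add: H_weight_def H_kernel_def)
  have C: "0 < ?C" using A B by (simp add: add_pos_pos)
  \<comment> \<open>The row constant enters with exponent \<open>1 / q\<close> and the column
    constant with \<open>1 / p\<close>, so the powers of \<open>?C\<close> recombine to
    \<open>?C\<close>.\<close>
  have const: "((?C / \<beta>) powr (p - 1) * (?C / \<alpha>)) powr (1 / p)
      = ?C / (\<alpha> powr (1 / p) * \<beta> powr (1 / q))"
  proof -
    have e: "(p - 1) * (1 / p) = 1 / q"
      using p by (simp add: q_inverse field_simps)
    have "((?C / \<beta>) powr (p - 1) * (?C / \<alpha>)) powr (1 / p)
      = (?C / \<beta>) powr (1 / q) * (?C / \<alpha>) powr (1 / p)"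
      by (simp only: powr_mult powr_powr e)
    also have "\<dots> = ?C powr (1 / q + 1 / p) / (\<alpha> powr (1 / p) * \<beta> powr (1 / q))"
      by (simp only: powr_divide powr_add) simp
    also have "1 / q + 1 / p = 1" using pq by simp
    finally show ?thesis using C by simp
  qed
  note * = Schur_test_lp[OF p _ _ w k _ _ row_sum_le col assms]
  show "summable (\<lambda>n. of_real (k (Suc m) (Suc n)) * a (Suc n))"
    by (rule *(1)) (use C \<alpha> \<beta> in auto)
  show "series_op w k a \<in> lp p"
    by (rule *(2)) (use C \<alpha> \<beta> in auto)
  show "lp_norm p (series_op w k a) \<le> ?C / (\<alpha> powr (1 / p) * \<beta> powr (1 / q)) * lp_norm p a"
    unfolding const[symmetric] by (rule *(3)) (use C \<alpha> \<beta> in auto)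
qed

section \<open>Test sequences and their images\<close>

definition test_seq :: "real \<Rightarrow> nat \<Rightarrow> complex" where
  "test_seq \<delta> n = of_real (real n powr - (1 / p + \<beta> * \<delta>))"

text \<open>At integers \<open>n \<ge> 1\<close> the kernel with \<open>a = 1\<close> and
  \<open>s = 1\<close> is a pure power, so the comparison bounds also estimate the norms:
  \<open>x = \<beta>\<close> for the test sequence, \<open>x = \<alpha>\<close> for the minorant of
  its image.\<close>

lemma powr_eq_max_kernel:
  "(real (Suc n) powr - (1 / p + x * \<delta>)) powr p = max_kernel 1 (x * (p * \<delta>)) 1 (real (Suc n))"
proof -
  have "- (1 / p + x * \<delta>) * p = - (1 + x * (p * \<delta>))"
    using p by (simp add: field_simps)
  then have "(real (Suc n) powr - (1 / p + x * \<delta>)) powr p = 1 / real (Suc n) powr (1 + x * (p * \<delta>))"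
    by (simp only: powr_powr powr_minus_divide[of _ "1 + x * (p * \<delta>)"])
  then show ?thesis
    by (simp add: max_kernel_def max_def)
qed

lemma norm_test_seq:
  "norm (test_seq \<delta> (Suc n)) powr p = max_kernel 1 (\<beta> * (p * \<delta>)) 1 (real (Suc n))"
  unfolding powr_eq_max_kernel[symmetric] test_seq_def norm_of_real by simp

lemma test_seq_in_lp: "0 < \<delta> \<Longrightarrow> test_seq \<delta> \<in> lp p"
  unfolding lp_def mem_Collect_eq norm_test_seq using \<beta> p
  by (intro summable_max_kernel) auto

lemma lp_norm_test_seq_le:
  assumes "0 < \<delta>"
  shows "lp_norm p (test_seq \<delta>) powr p \<le> 1 + 1 / (\<beta> * (p * \<delta>))"
proof -
  have "lp_norm p (test_seq \<delta>) powr p = (\<Sum>n. norm (test_seq \<delta> (Suc n)) powr p)"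
    using p test_seq_in_lp[OF assms]
    by (simp add: lp_norm_def lp_def powr_powr suminf_nonneg)
  also have "\<dots> \<le> 1 + 1 / (\<beta> * (p * \<delta>))"
    unfolding norm_test_seq
    using suminf_max_kernel_le[of 1 "\<beta> * (p * \<delta>)" 1] assms p \<beta> by simp
  finally show ?thesis .
qed

lemma lp_norm_test_seq_pos:
  assumes "0 < \<delta>"
  shows "0 < lp_norm p (test_seq \<delta>)"
proof -
  have "0 < (\<Sum>n. norm (test_seq \<delta> (Suc n)) powr p)"
    using test_seq_in_lp[OF assms] by (intro suminf_pos) (auto simp: lp_def test_seq_def)
  then show ?thesis by (simp add: lp_norm_def)
qed

text \<open>
  With \<open>\<delta> = 0\<close> and \<open>m \<rightarrow> \<infinity>\<close> this tends to \<open>(1/A + 1/B)/\<beta>\<close>. The term \<open>(m + 1)\<^bsup>-\<alpha>(A - \<delta>)\<^esup>\<close> comes from the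
  part of the comparison integral below \<open>1\<close>, which the sum over \<open>n \<ge> 1\<close> does not see.
\<close>

definition operator_lower :: "real \<Rightarrow> nat \<Rightarrow> real" where
  "operator_lower \<delta> m =
     ((1 - real (Suc m) powr - (\<alpha> * (A - \<delta>))) / (A - \<delta>) + 1 / (B + \<delta>)) / \<beta>"

lemma operator_lower_mono:
  assumes "\<delta> < A" "M \<le> m"
  shows "operator_lower \<delta> M \<le> operator_lower \<delta> m"
  unfolding operator_lower_def using assms \<alpha> \<beta>
  by (intro divide_right_mono add_right_mono diff_left_mono powr_mono2') auto

lemma operator_lower_nonneg:
  assumes "0 < \<delta>" "\<delta> < A"
  shows "0 \<le> operator_lower \<delta> M"
proof -
  \<comment> \<open>Since \<open>real (Suc 0) = 1\<close>, only the positive summand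
    \<open>1 / (B + \<delta>)\<close> survives.\<close>
  have "0 \<le> operator_lower \<delta> 0"
    using assms B \<beta> by (simp add: operator_lower_def)
  also have "\<dots> \<le> operator_lower \<delta> M"
    using assms by (intro operator_lower_mono) auto
  finally show ?thesis .
qed

text \<open>All terms are nonnegative, so the norm is a multiple of a max kernel sum with
  \<open>s \<ge> 1\<close>, to which the lower comparison applies.\<close>

lemma norm_op_test_seq_ge:
  assumes "0 < \<delta>" "\<delta> < A"
  shows "operator_lower \<delta> m * real (Suc m) powr - (1 / p + \<alpha> * \<delta>)
    \<le> norm (series_op w k (test_seq \<delta>) (Suc m))"
proof -
  let ?s = "real (Suc m) powr (\<alpha> / \<beta>)" and ?a = "\<beta> * (A - \<delta>)" and ?b = "\<beta> * (B + \<delta>)"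
  let ?c = "real (Suc m) powr (\<alpha> * B - 1 / p)"
  have a: "0 < ?a" "?a \<le> 1" and b: "0 < ?b" and s: "1 \<le> ?s"
    using assms A B \<alpha> \<beta> by (auto intro!: mult_le_one add_pos_pos ge_one_powr_ge_zero)
  have eq: "complex_of_real (w (Suc m)) * (of_real (k (Suc m) (Suc n)) * test_seq \<delta> (Suc n))
      = of_real (?c * max_kernel ?a ?b ?s (real (Suc n)))" for n
    unfolding row_kernel[symmetric] by (simp add: test_seq_def mult.assoc)
  have "series_op w k (test_seq \<delta>) (Suc m)
      = (\<Sum>n. of_real (w (Suc m)) * (of_real (k (Suc m) (Suc n)) * test_seq \<delta> (Suc n)))"
    unfolding series_op_def using assms by (intro suminf_mult[symmetric] operator_bounds test_seq_in_lp)
  also have "\<dots> = of_real (\<Sum>n. ?c * max_kernel ?a ?b ?s (real (Suc n)))"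
    unfolding eq using a b s
    by (intro suminf_of_real[symmetric] summable_mult summable_max_kernel) auto
  also have "\<dots> = of_real (?c * (\<Sum>n. max_kernel ?a ?b ?s (real (Suc n))))"
    by (subst suminf_mult[OF summable_max_kernel]) (use a b s in simp_all)
  finally have "norm (series_op w k (test_seq \<delta>) (Suc m))
      = \<bar>?c * (\<Sum>n. max_kernel ?a ?b ?s (real (Suc n)))\<bar>"
    by (simp only: norm_of_real)
  moreover have "?c * (((1 - ?s powr - ?a) / ?a + 1 / ?b) / ?s powr ?b)
      \<le> ?c * (\<Sum>n. max_kernel ?a ?b ?s (real (Suc n)))"
    using a b s by (intro mult_left_mono suminf_max_kernel_ge) auto
  moreover have "?c * (((1 - ?s powr - ?a) / ?a + 1 / ?b) / ?s powr ?b)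
      = operator_lower \<delta> m * real (Suc m) powr - (1 / p + \<alpha> * \<delta>)"
  proof -
    have 1: "?s powr - ?a = real (Suc m) powr - (\<alpha> * (A - \<delta>))"
      "?s powr ?b = real (Suc m) powr (\<alpha> * (B + \<delta>))"
      using \<beta> by (simp_all add: powr_powr)
    have "?c / real (Suc m) powr (\<alpha> * (B + \<delta>)) = real (Suc m) powr - (1 / p + \<alpha> * \<delta>)"
      by (simp add: powr_diff[symmetric] algebra_simps)
    then have "?c * (x / ?s powr ?b) = x * real (Suc m) powr - (1 / p + \<alpha> * \<delta>)" for x
      unfolding 1 by (metis mult.commute times_divide_eq_left times_divide_eq_right)
    moreover have "(1 - ?s powr - ?a) / ?a + 1 / ?b = operator_lower \<delta> m"
      unfolding 1 operator_lower_def by (simp add: add_divide_distrib mult.commute)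
    ultimately show ?thesis by simp
  qed
  ultimately show ?thesis by linarith
qed

section \<open>The lower estimate\<close>

text \<open>The bounds on the \<open>p\<close>-th powers of the norms grow like
  \<open>1 / \<delta>\<close>; multiplication by \<open>p * \<delta>\<close> leaves finite limits as
  \<open>\<delta> \<rightarrow> 0\<close>. Only the rows from \<open>M\<close> on are kept, where
  \<open>operator_lower \<delta> m\<close> is at least its value at \<open>M\<close>.\<close>

lemma test_seq_inequality:
  assumes N: "\<And>a. a \<in> lp p \<Longrightarrow> lp_norm p (series_op w k a) \<le> N * lp_norm p a"
    and \<delta>: "0 < \<delta>" "\<delta> < A"
  shows "0 \<le> N"
    and "operator_lower \<delta> M powr p * (1 / \<alpha> - real M * (p * \<delta>)) \<le> N powr p * (p * \<delta> + 1 / \<beta>)"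
proof -
  let ?a = "test_seq \<delta>" and ?R = "operator_lower \<delta> M" and ?c = "\<alpha> * (p * \<delta>)"
  let ?T = "\<lambda>m. norm (series_op w k ?a (Suc m)) powr p"
  let ?f = "\<lambda>m. max_kernel 1 ?c 1 (real (Suc m))"
  have c: "0 < ?c" using \<alpha> p \<delta> by simp
  have le: "lp_norm p (series_op w k ?a) \<le> N * lp_norm p ?a"
    by (rule N[OF test_seq_in_lp[OF \<delta>(1)]])
  have "0 \<le> N * lp_norm p ?a"
    using le lp_norm_nonneg order_trans by blast
  then show "0 \<le> N"
    using lp_norm_test_seq_pos[OF \<delta>(1)] by (simp add: zero_le_mult_iff)
  have T: "summable ?T"
    using operator_bounds(2)[OF test_seq_in_lp[OF \<delta>(1)]] by (simp add: lp_def)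
  have f: "summable ?f"
    using c by (intro summable_max_kernel) auto
  have f_eq: "?f m = (real (Suc m) powr - (1 / p + \<alpha> * \<delta>)) powr p" for m
    by (rule powr_eq_max_kernel[symmetric])
  \<comment> \<open>This limits the loss from discarding the first \<open>M\<close> rows to
    \<open>real M\<close>.\<close>
  have f_le: "?f m \<le> 1" for m
    using c ge_one_powr_ge_zero[of "real (Suc m)" "1 + ?c"]
    by (simp add: max_kernel_def max_def)
  have tail: "?R powr p * ?f m \<le> ?T m" if "M \<le> m" for m
  proof -
    have "?R * real (Suc m) powr - (1 / p + \<alpha> * \<delta>)
        \<le> operator_lower \<delta> m * real (Suc m) powr - (1 / p + \<alpha> * \<delta>)"
      using that \<delta> by (intro mult_right_mono operator_lower_mono) auto
    also have "\<dots> \<le> norm (series_op w k ?a (Suc m))"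
      using \<delta> by (rule norm_op_test_seq_ge)
    finally have "(?R * real (Suc m) powr - (1 / p + \<alpha> * \<delta>)) powr p \<le> ?T m"
      using p operator_lower_nonneg[OF \<delta>] by (intro powr_mono2) auto
    then show ?thesis
      unfolding f_eq using operator_lower_nonneg[OF \<delta>] by (simp add: powr_mult)
  qed
  have "(\<Sum>m. ?R powr p * ?f (m + M)) \<le> (\<Sum>m. ?T (m + M))"
    using tail[of "m + M" for m]
    by (intro suminf_le summable_mult summable_ignore_initial_segment[OF T]
      summable_ignore_initial_segment[OF f]) auto
  also have "\<dots> \<le> suminf ?T"
    using suminf_split_initial_segment[OF T, of M] by (simp add: sum_nonneg)
  also have "suminf ?T = lp_norm p (series_op w k ?a) powr p"
    using p T by (simp add: lp_norm_def powr_powr suminf_nonneg)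
  also have "\<dots> \<le> (N * lp_norm p ?a) powr p"
    using p le by (intro powr_mono2 lp_norm_nonneg) auto
  also have "\<dots> = N powr p * lp_norm p ?a powr p"
    using \<open>0 \<le> N\<close> by (simp add: powr_mult lp_norm_nonneg)
  also have "\<dots> \<le> N powr p * (1 + 1 / (\<beta> * (p * \<delta>)))"
    by (intro mult_left_mono lp_norm_test_seq_le \<delta>) auto
  finally have upper: "(\<Sum>m. ?R powr p * ?f (m + M)) \<le> N powr p * (1 + 1 / (\<beta> * (p * \<delta>)))" .
  have "(\<Sum>m<M. ?f m) \<le> real M"
    using sum_mono[of "{..<M}" ?f "\<lambda>_. 1"] f_le by simp
  \<comment> \<open>With \<open>s = 1\<close> the term divided by \<open>a\<close> in the lower
    comparison vanishes.\<close>
  moreover have "1 / ?c \<le> suminf ?f"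
    using suminf_max_kernel_ge[of 1 ?c 1] c by simp
  ultimately have "1 / ?c - real M \<le> (\<Sum>m. ?f (m + M))"
    using suminf_split_initial_segment[OF f, of M] by simp
  then have "?R powr p * (1 / ?c - real M) \<le> ?R powr p * (\<Sum>m. ?f (m + M))"
    by (rule mult_left_mono) simp
  also have "\<dots> = (\<Sum>m. ?R powr p * ?f (m + M))"
    by (rule suminf_mult[symmetric]) (rule summable_ignore_initial_segment[OF f])
  also note upper
  finally have "(?R powr p * (1 / ?c - real M)) * (p * \<delta>)
      \<le> (N powr p * (1 + 1 / (\<beta> * (p * \<delta>)))) * (p * \<delta>)"
    using p \<delta> by (intro mult_right_mono) auto
  moreover have "(1 / ?c - real M) * (p * \<delta>) = 1 / \<alpha> - real M * (p * \<delta>)"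
    using p \<delta> \<alpha> by (simp add: left_diff_distrib)
  moreover have "(1 + 1 / (\<beta> * (p * \<delta>))) * (p * \<delta>) = p * \<delta> + 1 / \<beta>"
    using p \<delta> \<beta> by (simp add: distrib_right)
  ultimately show "?R powr p * (1 / \<alpha> - real M * (p * \<delta>)) \<le> N powr p * (p * \<delta> + 1 / \<beta>)"
    by (simp add: mult.assoc)
qed

text \<open>First \<open>\<delta> \<rightarrow> 0\<close> with \<open>M\<close> fixed, which removes
  the loss \<open>real M * (p * \<delta>)\<close>, then \<open>M \<rightarrow> \<infinity>\<close>,
  which brings \<open>operator_lower 0 M\<close> up to \<open>?C / \<beta>\<close>.\<close>

lemma operator_norm_ge:
  assumes N: "\<And>a. a \<in> lp p \<Longrightarrow> lp_norm p (series_op w k a) \<le> N * lp_norm p a"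
  shows "(1 / A + 1 / B) / (\<alpha> powr (1 / p) * \<beta> powr (1 / q)) \<le> N"
proof -
  let ?C = "1 / A + 1 / B"
  have C: "0 < ?C" using A B by (simp add: add_pos_pos)
  have small: "\<forall>\<^sub>F \<delta> in at_right 0. 0 < \<delta> \<and> \<delta> < A"
    using eventually_at_right_real[of 0 A] A by simp
  \<comment> \<open>A single test sequence shows \<open>0 \<le> N\<close>, which recovers
    \<open>N\<close> from \<open>N powr p\<close> at the end.\<close>
  obtain \<delta> where "0 < \<delta>" "\<delta> < A" using dense A by blast
  then have "0 \<le> N" using test_seq_inequality(1)[OF N] by blast
  have "operator_lower 0 M powr p * (1 / \<alpha>) \<le> N powr p * (1 / \<beta>)" for M
  proof (rule tendsto_le[OF trivial_limit_at_right_real])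
    have "((\<lambda>\<delta>. operator_lower \<delta> M) \<longlongrightarrow> operator_lower 0 M) (at_right 0)"
      unfolding operator_lower_def using A B \<beta> by (auto intro!: tendsto_eq_intros)
    then have "((\<lambda>\<delta>. operator_lower \<delta> M powr p) \<longlongrightarrow> operator_lower 0 M powr p) (at_right 0)"
      using p small
      by (intro tendsto_powr2) (auto elim!: eventually_mono intro: operator_lower_nonneg)
    moreover have "((\<lambda>\<delta>. 1 / \<alpha> - real M * (p * \<delta>)) \<longlongrightarrow> 1 / \<alpha>) (at_right 0)"
      by (auto intro!: tendsto_eq_intros)
    ultimately show "((\<lambda>\<delta>. operator_lower \<delta> M powr p * (1 / \<alpha> - real M * (p * \<delta>)))
        \<longlongrightarrow> operator_lower 0 M powr p * (1 / \<alpha>)) (at_right 0)"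
      by (rule tendsto_mult)
    show "((\<lambda>\<delta>. N powr p * (p * \<delta> + 1 / \<beta>)) \<longlongrightarrow> N powr p * (1 / \<beta>)) (at_right 0)"
      by (auto intro!: tendsto_eq_intros)
    show "\<forall>\<^sub>F \<delta> in at_right 0. operator_lower \<delta> M powr p * (1 / \<alpha> - real M * (p * \<delta>))
        \<le> N powr p * (p * \<delta> + 1 / \<beta>)"
      using small by eventually_elim (use test_seq_inequality(2)[OF N] in blast)
  qed
  moreover have "(\<lambda>M. operator_lower 0 M powr p * (1 / \<alpha>)) \<longlonglongrightarrow> (?C / \<beta>) powr p * (1 / \<alpha>)"
  proof -
    have lim: "(\<lambda>M. real (Suc M) powr - (\<alpha> * A)) \<longlonglongrightarrow> 0"
      using A \<alpha> by (intro tendsto_neg_powr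
        filterlim_compose[OF filterlim_real_sequentially filterlim_Suc]) auto
    have "(\<lambda>M. ((1 - real (Suc M) powr - (\<alpha> * A)) / A + 1 / B) / \<beta>)
        \<longlonglongrightarrow> ((1 - 0) / A + 1 / B) / \<beta>"
      using A \<beta> by (intro tendsto_divide tendsto_add tendsto_diff tendsto_const lim) auto
    then have "operator_lower 0 \<longlonglongrightarrow> ?C / \<beta>"
      by (simp add: operator_lower_def[abs_def])
    then show ?thesis
      using C \<beta> by (intro tendsto_intros) auto
  qed
  ultimately have "(?C / \<beta>) powr p * (1 / \<alpha>) \<le> N powr p * (1 / \<beta>)"
    by (intro LIMSEQ_le_const2) auto
  then have "(?C / \<beta>) powr p * (1 / \<alpha>) * \<beta> \<le> N powr p"
    using \<beta> by (simp add: field_simps)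
  then have "((?C / \<beta>) powr p * (1 / \<alpha>) * \<beta>) powr (1 / p) \<le> (N powr p) powr (1 / p)"
    using p \<alpha> \<beta> by (intro powr_mono2) auto
  also have "\<dots> = N" using p \<open>0 \<le> N\<close> by (simp add: powr_powr)
  also have "((?C / \<beta>) powr p * (1 / \<alpha>) * \<beta>) powr (1 / p)
      = ?C / \<beta> * (1 / \<alpha> powr (1 / p)) * \<beta> powr (1 / p)"
    using C p \<alpha> \<beta> by (simp add: powr_mult powr_powr powr_divide)
  also have "\<beta> powr (1 / p) = \<beta> / \<beta> powr (1 / q)"
    using \<beta> by (simp add: q_inverse powr_diff)
  also have "?C / \<beta> * (1 / \<alpha> powr (1 / p)) * (\<beta> / \<beta> powr (1 / q))
      = ?C / (\<alpha> powr (1 / p) * \<beta> powr (1 / q))"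
    using \<beta> by simp
  finally show ?thesis .
qed

end

theorem theorem1p3:
  fixes p p' \<alpha> \<beta> \<mu> \<nu> :: real
  assumes "p > 1" and "1 / p + 1 / p' = 1"
    and "0 < \<alpha>" "\<alpha> \<le> 1" and "0 < \<beta>" "\<beta> \<le> 1"
    and "-1 < \<mu>" "\<mu> < p - 1" and "-1 < \<nu>" "\<nu> < p - 1"
  shows "bounded_on_lp p (H_weight p \<alpha> \<mu>) (H_kernel p p' \<alpha> \<beta> \<mu> \<nu>) \<and>
    lp_op_norm p (H_weight p \<alpha> \<mu>) (H_kernel p p' \<alpha> \<beta> \<mu> \<nu>) =
      p / (\<alpha> powr (1 / p) * \<beta> powr (1 / p')) * (1 / (1 + \<mu>) + 1 / (p - 1 - \<nu>))"
proof -
  let ?w = "H_weight p \<alpha> \<mu>" and ?k = "H_kernel p p' \<alpha> \<beta> \<mu> \<nu>"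
  let ?D = "(1 / ((p - 1 - \<nu>) / p) + 1 / ((1 + \<mu>) / p)) / (\<alpha> powr (1 / p) * \<beta> powr (1 / p'))"
  \<comment> \<open>The four bounds on \<open>\<mu>\<close> and \<open>\<nu>\<close> say exactly
    that both quotients lie strictly between 0 and 1.\<close>
  have AB: "0 < (p - 1 - \<nu>) / p" "(p - 1 - \<nu>) / p < 1" "0 < (1 + \<mu>) / p" "(1 + \<mu>) / p < 1"
    using assms by auto
  note bounds = operator_bounds[OF assms(1-6) AB]
  have D: "p / (\<alpha> powr (1 / p) * \<beta> powr (1 / p')) * (1 / (1 + \<mu>) + 1 / (p - 1 - \<nu>)) = ?D"
  proof -
    have "p / X * (1 / a + 1 / b) = (1 / (b / p) + 1 / (a / p)) / X" for X a b :: real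
      by (simp add: add_divide_distrib distrib_left mult.commute)
    then show ?thesis .
  qed
  \<comment> \<open>The bounds are indexed by \<open>Suc m\<close>, hence the shift to
    \<open>m - 1\<close>.\<close>
  have "summable (\<lambda>n. of_real (?k m (Suc n)) * a (Suc n))" if "a \<in> lp p" "1 \<le> m" for a m
    using bounds(1)[OF that(1), of "m - 1"] that(2) by simp
  then have "bounded_on_lp p ?w ?k"
    unfolding bounded_on_lp_def by (intro conjI ballI allI impI exI[of _ ?D] bounds(2,3))
  moreover have "lp_op_norm p ?w ?k = ?D"
    unfolding lp_op_norm_def
  proof (rule Least_equality)
    show "\<forall>a\<in>lp p. lp_norm p (series_op ?w ?k a) \<le> ?D * lp_norm p a"
      by (intro ballI bounds(3))
    show "?D \<le> N" if "\<forall>a\<in>lp p. lp_norm p (series_op ?w ?k a) \<le> N * lp_norm p a" for N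
      by (rule operator_norm_ge[OF assms(1-6) AB]) (rule that[rule_format])
  qed
  ultimately show ?thesis by (simp only: D)
qed

end
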